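(* Let $C=\{c_0,c_1,\ldots,c_k\}$ be a subset of the ground set of $M[P,Q]$ with $c_0<c_1<\cdots<c_k$, and let $n(C)=\{i_1,\ldots,i_s\}$ with $i_1<\cdots<i_s$. Then $C$ is a circuit of $M[P,Q]$ if and only if (1) $s=k$, (2) $c_0\in N_{i_1}$, (3) $c_k\in N_{i_k}$, and (4) $c_j\in N_{i_j}\cap N_{i_{j+1}}$ for all $j$ with $0<j<k$. Furthermore, if $C$ is a circuit, then $i_{h+1}=i_h+1$ for $1\le h<k$.
   Context: Lattice paths start at $(0,0)$ and use steps $E=(1,0)$ and $N=(0,1)$. For lattice paths $P,Q$ from $(0,0)$ to $(m,r)$ with $P$ never going above $Q$, let $\mathcal{P}$ be the set of lattice paths from $(0,0)$ to $(m,r)$ going neither above $Q$ nor below $P$, and for $1\le i\le r$ let $N_i=\{j:\text{step } j \text{ is the } i\text{-th North step of some path in }\mathcal{P}\}$. $M[P,Q]$ is the transversal matroid on $[m+r]$ with presentation $(N_1,\ldots,N_r)$, with the natural order on $[m+r]$. Its incidence function is $n(X)=\{i\in[r]: X\cap N_i\neq\emptyset\}$. *)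

theory Defs
  imports Main
begin

datatype step = East | North

type_synonym lattice_path = "step list"

definition lattice_paths :: "nat \<Rightarrow> nat \<Rightarrow> lattice_path set" where
  "lattice_paths m r = {p. count_list p East = m \<and> count_list p North = r}"

definition path_points :: "lattice_path \<Rightarrow> (nat \<times> nat) set" where
  "path_points p =
     {(count_list (take t p) East, count_list (take t p) North) | t. t \<le> length p}"

text \<open>Heights are compared on each vertical line. Since a path may have several points on the
  line \<open>x\<close>, a point \<open>(x, y)\<close> is above \<open>q\<close> if it is higher than all of them, and below \<open>q\<close> if it
  is lower than all of them. It suffices to look at lattice points.\<close>

definition never_above :: "lattice_path \<Rightarrow> lattice_path \<Rightarrow> bool" where
  "never_above p q \<longleftrightarrow> (\<forall>(x, y) \<in> path_points p. \<exists>y'. (x, y') \<in> path_points q \<and> y \<le> y')"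

definition never_below :: "lattice_path \<Rightarrow> lattice_path \<Rightarrow> bool" where
  "never_below p q \<longleftrightarrow> (\<forall>(x, y) \<in> path_points p. \<exists>y'. (x, y') \<in> path_points q \<and> y' \<le> y)"

definition paths_between :: "nat \<Rightarrow> nat \<Rightarrow> lattice_path \<Rightarrow> lattice_path \<Rightarrow> lattice_path set" where
  "paths_between m r P Q = {p \<in> lattice_paths m r. never_above p Q \<and> never_below p P}"

text \<open>Steps are numbered from 1, list positions from 0.\<close>

definition is_nth_north :: "lattice_path \<Rightarrow> nat \<Rightarrow> nat \<Rightarrow> bool" where
  "is_nth_north p i j \<longleftrightarrow>
     1 \<le> j \<and> j \<le> length p \<and> p ! (j - 1) = North \<and> count_list (take j p) North = i"

definition north_set :: "nat \<Rightarrow> nat \<Rightarrow> lattice_path \<Rightarrow> lattice_path \<Rightarrow> nat \<Rightarrow> nat set" where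
  "north_set m r P Q i = {j. \<exists>p \<in> paths_between m r P Q. is_nth_north p i j}"

text \<open>A matroid is given by its ground set and its collection of independent sets; the type does
  not enforce the matroid axioms.\<close>

type_synonym 'a set_system = "'a set \<times> 'a set set"

definition ground :: "'a set_system \<Rightarrow> 'a set" where
  "ground M = fst M"

definition indep_sets :: "'a set_system \<Rightarrow> 'a set set" where
  "indep_sets M = snd M"

definition circuit :: "'a set_system \<Rightarrow> 'a set \<Rightarrow> bool" where
  "circuit M C \<longleftrightarrow>
     C \<subseteq> ground M \<and> C \<notin> indep_sets M \<and> (\<forall>X. X \<subset> C \<longrightarrow> X \<in> indep_sets M)"

definition partial_transversal :: "'i set \<Rightarrow> ('i \<Rightarrow> 'a set) \<Rightarrow> 'a set \<Rightarrow> bool" where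
  "partial_transversal I A X \<longleftrightarrow> (\<exists>f. inj_on f X \<and> (\<forall>x \<in> X. f x \<in> I \<and> x \<in> A (f x)))"

definition transversal_matroid :: "'a set \<Rightarrow> 'i set \<Rightarrow> ('i \<Rightarrow> 'a set) \<Rightarrow> 'a set_system" where
  "transversal_matroid S I A = (S, {X. X \<subseteq> S \<and> partial_transversal I A X})"

definition lattice_path_matroid ::
    "nat \<Rightarrow> nat \<Rightarrow> lattice_path \<Rightarrow> lattice_path \<Rightarrow> nat set_system" where
  "lattice_path_matroid m r P Q = transversal_matroid {1..m + r} {1..r} (north_set m r P Q)"

definition incidence ::
    "nat \<Rightarrow> nat \<Rightarrow> lattice_path \<Rightarrow> lattice_path \<Rightarrow> nat set \<Rightarrow> nat set" where
  "incidence m r P Q X = {i \<in> {1..r}. X \<inter> north_set m r P Q i \<noteq> {}}"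

end

theory Submission
  imports Defs
begin

text \<open>Write \<open>h\<^sub>P t\<close> and \<open>h\<^sub>Q t\<close> for the number of North steps among the first \<open>t\<close> steps of \<open>P\<close>
  and \<open>Q\<close>. Clipping a one-step staircase between \<open>P\<close> and \<open>Q\<close> shows that \<open>j \<in> N\<^sub>i\<close> iff
  \<open>h\<^sub>P (j - 1) < i \<le> h\<^sub>Q j\<close>, so each element \<open>j\<close> can be matched exactly to an integer interval
  \<open>{a j..b j}\<close> whose two ends are monotone in \<open>j\<close>.
  If every segment \<open>c\<^sub>u, \<dots>, c\<^sub>v\<close> of \<open>C\<close> satisfies the counting bound \<open>a c\<^sub>u + (v - u) \<le> b c\<^sub>v\<close>,
  then the greedy assignment matches \<open>C\<close>. In a circuit only the full segment can violate it; so
  \<open>C\<close> is incident with exactly \<open>k\<close> consecutive indices, and the bounds for the proper segments are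
  the remaining conditions. Conversely, after deleting \<open>c\<^sub>h\<close> from a set satisfying the conditions,
  match \<open>c\<^sub>j\<close> to \<open>i\<^sub>j\<^sub>+\<^sub>1\<close> for \<open>j < h\<close> and to \<open>i\<^sub>j\<close> for \<open>j > h\<close>.\<close>

section \<open>Heights of lattice paths\<close>

definition prefix_count :: "lattice_path \<Rightarrow> step \<Rightarrow> nat \<Rightarrow> nat" where
  "prefix_count p x t = count_list (take t p) x"

abbreviation "width p \<equiv> prefix_count p East"
abbreviation "height p \<equiv> prefix_count p North"

lemma prefix_count_0 [simp]: "prefix_count p x 0 = 0"
  by (simp add: prefix_count_def)

lemma prefix_count_Suc:
  "prefix_count p x (Suc t) = prefix_count p x t + (if t < length p \<and> p ! t = x then 1 else 0)"
  by (cases "t < length p") (simp_all add: prefix_count_def take_Suc_conv_app_nth)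

lemma mono_prefix_count: "mono (prefix_count p x)"
  by (rule mono_iff_le_Suc[THEN iffD2]) (simp add: prefix_count_Suc)

lemma prefix_count_mono: "s \<le> t \<Longrightarrow> prefix_count p x s \<le> prefix_count p x t"
  by (rule monoD[OF mono_prefix_count])

lemma width_plus_height: "t \<le> length p \<Longrightarrow> width p t + height p t = t"
  by (induction t) (use step.exhaust in \<open>auto simp: prefix_count_Suc\<close>)

lemma path_points_eq: "path_points p = {(width p t, height p t) | t. t \<le> length p}"
  by (simp add: path_points_def prefix_count_def)

lemma lattice_paths_iff:
  "p \<in> lattice_paths m r \<longleftrightarrow>
     length p = m + r \<and> width p (m + r) = m \<and> height p (m + r) = r"
proof
  assume "p \<in> lattice_paths m r"
  then show "length p = m + r \<and> width p (m + r) = m \<and> height p (m + r) = r"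
    using width_plus_height[of "length p" p] by (auto simp: lattice_paths_def prefix_count_def)
qed (auto simp: lattice_paths_def prefix_count_def)

text \<open>Discrete intermediate value property: one step raises a count by at most 1.\<close>

lemma prefix_count_attained:
  assumes "s \<le> t" "prefix_count p x s \<le> n" "n \<le> prefix_count p x t"
  shows "\<exists>u. s \<le> u \<and> u \<le> t \<and> prefix_count p x u = n"
  using assms
proof (induction t rule: dec_induct)
  case (step t)
  show ?case
  proof (cases "n \<le> prefix_count p x t")
    case True
    then show ?thesis using step by (meson le_SucI)
  next
    case False
    then have "prefix_count p x (Suc t) = n"
      using step.prems by (simp add: prefix_count_Suc split: if_splits)
    then show ?thesis using step by (intro exI[of _ "Suc t"]) simp
  qed
qed force

text \<open>The definition compares the paths on vertical lines, the height condition on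
  antidiagonals x + y = t. If \<open>q\<close> meets the column of \<open>p\<close> at time
  \<open>t\<close> at least as high, it does so at a time \<open>u \<ge> t\<close>, so at time
  \<open>t\<close> its width is at most that of \<open>p\<close>. Conversely, such a
  \<open>q\<close> still has to reach that column later.\<close>

lemma never_above_iff_height:
  assumes p: "p \<in> lattice_paths m r" and q: "q \<in> lattice_paths m r"
  shows "never_above p q \<longleftrightarrow> (\<forall>t \<le> m + r. height p t \<le> height q t)"
proof -
  note len = p[unfolded lattice_paths_iff] q[unfolded lattice_paths_iff]
  have sum: "width p t + height p t = t" "width q t + height q t = t" if "t \<le> m + r" for t
    using that len width_plus_height by simp_all
  have "never_above p q \<longleftrightarrow>
      (\<forall>t \<le> m + r. \<exists>u \<le> m + r. width q u = width p t \<and> height p t \<le> height q u)"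
    unfolding never_above_def path_points_eq using len by (simp add: Ball_def) metis
  also have "\<dots> \<longleftrightarrow> (\<forall>t \<le> m + r. height p t \<le> height q t)"
  proof (intro all_cong1 imp_cong refl iffI)
    fix t assume t: "t \<le> m + r"
    assume "\<exists>u \<le> m + r. width q u = width p t \<and> height p t \<le> height q u"
    then obtain u where u: "u \<le> m + r" "width q u = width p t" "height p t \<le> height q u"
      by blast
    then have "t \<le> u" using sum[OF t] sum[OF u(1)] by linarith
    then have "width q t \<le> width q u" by (rule prefix_count_mono)
    then show "height p t \<le> height q t" using u(2) sum[OF t] by linarith
  next
    fix t assume t: "t \<le> m + r" and le: "height p t \<le> height q t"
    have "width q t \<le> width p t" "width p t \<le> width q (m + r)"
      using le sum[OF t] prefix_count_mono[OF t, of p East] len by simp_all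
    then obtain u where u: "t \<le> u" "u \<le> m + r" "width q u = width p t"
      using prefix_count_attained[OF t] by blast
    moreover have "height p t \<le> height q u"
      using u sum[OF t] sum[OF u(2)] by linarith
    ultimately show "\<exists>u \<le> m + r. width q u = width p t \<and> height p t \<le> height q u" by blast
  qed
  finally show ?thesis .
qed

text \<open>Mirror image: the point of \<open>q\<close> now lies at a time \<open>u \<le> t\<close>,
  so it is sought between the origin and time \<open>t\<close>.\<close>

lemma never_below_iff_height:
  assumes p: "p \<in> lattice_paths m r" and q: "q \<in> lattice_paths m r"
  shows "never_below p q \<longleftrightarrow> (\<forall>t \<le> m + r. height q t \<le> height p t)"
proof -
  note len = p[unfolded lattice_paths_iff] q[unfolded lattice_paths_iff]
  have sum: "width p t + height p t = t" "width q t + height q t = t" if "t \<le> m + r" for t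
    using that len width_plus_height by simp_all
  have "never_below p q \<longleftrightarrow>
      (\<forall>t \<le> m + r. \<exists>u \<le> m + r. width q u = width p t \<and> height q u \<le> height p t)"
    unfolding never_below_def path_points_eq using len by (simp add: Ball_def) metis
  also have "\<dots> \<longleftrightarrow> (\<forall>t \<le> m + r. height q t \<le> height p t)"
  proof (intro all_cong1 imp_cong refl iffI)
    fix t assume t: "t \<le> m + r"
    assume "\<exists>u \<le> m + r. width q u = width p t \<and> height q u \<le> height p t"
    then obtain u where u: "u \<le> m + r" "width q u = width p t" "height q u \<le> height p t"
      by blast
    then have "u \<le> t" using sum[OF t] sum[OF u(1)] by linarith
    then have "width q u \<le> width q t" by (rule prefix_count_mono)
    then show "height q t \<le> height p t" using u(2) sum[OF t] by linarith
  next
    fix t assume t: "t \<le> m + r" and le: "height q t \<le> height p t"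
    have "width q 0 \<le> width p t" "width p t \<le> width q t"
      using le sum[OF t] by simp_all
    then obtain u where u: "u \<le> t" "width q u = width p t"
      using prefix_count_attained[of 0 t] by blast
    moreover have "height q u \<le> height p t"
      using u t sum[OF t] sum[of u] by linarith
    ultimately show "\<exists>u \<le> m + r. width q u = width p t \<and> height q u \<le> height p t"
      using t by (intro exI[of _ u]) simp
  qed
  finally show ?thesis .
qed

section \<open>Membership in \<open>north_set\<close> in terms of heights\<close>

lemma path_with_heights:
  assumes "f 0 = 0" and "\<And>t. f (Suc t) = f t \<or> f (Suc t) = Suc (f t)"
  obtains p where "length p = n" "\<And>t. t \<le> n \<Longrightarrow> height p t = f t"
proof
  let ?p = "map (\<lambda>t. if f (Suc t) = f t then East else North) [0..<n]"
  show "length ?p = n" by simp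
  show "height ?p t = f t" if "t \<le> n" for t
    using that
  proof (induction t)
    case (Suc t)
    then show ?case using assms(2)[of t] by (auto simp: prefix_count_Suc)
  qed (simp add: assms)
qed

lemma is_nth_north_iff_height:
  "is_nth_north p i j \<longleftrightarrow> 1 \<le> j \<and> j \<le> length p \<and> Suc (height p (j - 1)) = i \<and> height p j = i"
  by (cases j) (auto simp: is_nth_north_def prefix_count_Suc simp flip: prefix_count_def)

lemma north_set_iff:
  assumes P: "P \<in> lattice_paths m r" and Q: "Q \<in> lattice_paths m r" and PQ: "never_above P Q"
    and j: "j \<in> {1..m + r}"
  shows "j \<in> north_set m r P Q i \<longleftrightarrow> Suc (height P (j - 1)) \<le> i \<and> i \<le> height Q j"
proof
  assume "j \<in> north_set m r P Q i"
  then obtain p where p: "p \<in> lattice_paths m r" "never_above p Q" "never_below p P"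
    and "is_nth_north p i j"
    by (auto simp: north_set_def paths_between_def)
  then have "Suc (height p (j - 1)) = i" "height p j = i"
    by (auto simp: is_nth_north_iff_height)
  moreover have "height P (j - 1) \<le> height p (j - 1)" "height p j \<le> height Q j"
    using p j never_above_iff_height[OF p(1) Q] never_below_iff_height[OF p(1) P] by auto
  ultimately show "Suc (height P (j - 1)) \<le> i \<and> i \<le> height Q j" by simp
next
  assume i: "Suc (height P (j - 1)) \<le> i \<and> i \<le> height Q j"
  note len = P[unfolded lattice_paths_iff] Q[unfolded lattice_paths_iff]
  \<comment> \<open>\<open>g\<close> is the staircase that rises once, at step \<open>j\<close>,
    from \<open>i - 1\<close> to \<open>i\<close>; \<open>f\<close> clamps it between the heights of
    \<open>P\<close> and \<open>Q\<close>.\<close>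
  define g where "g t = (if t < j then i - 1 else i)" for t
  define f where "f t = max (height P t) (min (height Q t) (g t))" for t
  have PQ': "height P t \<le> height Q t" if "t \<le> m + r" for t
    using PQ that never_above_iff_height[OF P Q] by simp
  \<comment> \<open>Each of the three sequences moves by 0 or 1 per step, and \<open>max\<close> and
    \<open>min\<close> preserve this.\<close>
  have step: "f (Suc t) = f t \<or> f (Suc t) = Suc (f t)" for t
  proof -
    have "height P (Suc t) = height P t \<or> height P (Suc t) = Suc (height P t)"
      "height Q (Suc t) = height Q t \<or> height Q (Suc t) = Suc (height Q t)"
      "g (Suc t) = g t \<or> g (Suc t) = Suc (g t)"
      using i by (auto simp: prefix_count_Suc g_def)
    then show ?thesis unfolding f_def by linarith
  qed
  obtain p where p: "length p = m + r" "\<And>t. t \<le> m + r \<Longrightarrow> height p t = f t"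
  proof (rule path_with_heights)
    show "f 0 = 0" by (simp add: f_def)
  qed (use step in auto)
  have "f (m + r) = r" by (simp add: f_def len)
  then have path: "p \<in> lattice_paths m r"
    using p(1) p(2)[of "m + r"] width_plus_height[of "m + r" p] by (simp add: lattice_paths_iff)
  moreover have "never_above p Q"
    using never_above_iff_height[OF path Q] p(2) PQ' by (simp add: f_def)
  moreover have "never_below p P"
    using never_below_iff_height[OF path P] p(2) by (simp add: f_def)
  moreover have "is_nth_north p i j"
  proof -
    obtain l where l: "j = Suc l" using j by (cases j) auto
    \<comment> \<open>Clamping does not disturb \<open>g\<close> at \<open>l\<close> and
      \<open>j\<close>: a step changes a height by at most 1, so the bounds on \<open>i\<close> also
      give \<open>height Q l \<ge> i - 1\<close> and \<open>height P j \<le> i\<close>.\<close>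
    have "f l = i - 1" "f j = i"
      using i l by (auto simp: f_def g_def prefix_count_Suc split: if_splits)
    then show ?thesis
      using i j l p by (auto simp: is_nth_north_iff_height)
  qed
  ultimately show "j \<in> north_set m r P Q i"
    by (auto simp: north_set_def paths_between_def)
qed

section \<open>Transversal systems presented by monotone intervals\<close>

lemma strict_mono_on_add_diff_le:
  fixes f :: "nat \<Rightarrow> nat"
  assumes "strict_mono_on {l..n} f" and "l \<le> u" and "u \<le> v" and "v \<le> n"
  shows "f u + (v - u) \<le> f v"
  using assms(3,4)
proof (induction v rule: dec_induct)
  case (step v)
  then have "f v < f (Suc v)"
    using assms(2) by (intro strict_mono_onD[OF assms(1)]) auto
  then show ?case using step by simp
qed simp

text \<open>The values start at \<open>A\<close> or later and end before \<open>A + k\<close>, so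
  increments of at least 1 pin \<open>i h\<close> from both sides. The \<open>Suc\<close> avoids a
  truncated subtraction.\<close>

lemma strict_mono_on_enum_interval:
  fixes i :: "nat \<Rightarrow> nat"
  assumes "strict_mono_on {1..k} i" and "i ` {1..k} = {A..<A + k}" and "h \<in> {1..k}"
  shows "Suc (i h) = A + h"
proof -
  have "i 1 \<in> {A..<A + k}" "i k \<in> {A..<A + k}"
    using assms(3) by (auto simp flip: assms(2))
  then show ?thesis
    using strict_mono_on_add_diff_le[OF assms(1), of 1 h]
      strict_mono_on_add_diff_le[OF assms(1), of h k] assms(3)
    by auto
qed

text \<open>The circuit argument uses only this interval form, so it is detached from paths. If
  \<open>b x < a x\<close>, the interval is empty and \<open>x\<close> is a loop.\<close>

locale interval_presentation =
  fixes S :: "'a :: linorder set" and I :: "nat set" and N :: "nat \<Rightarrow> 'a set"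
    and a b :: "'a \<Rightarrow> nat"
  assumes mem_iff: "x \<in> S \<Longrightarrow> n \<in> I \<Longrightarrow> x \<in> N n \<longleftrightarrow> a x \<le> n \<and> n \<le> b x"
    and interval_subset: "x \<in> S \<Longrightarrow> {a x..b x} \<subseteq> I"
    and mono_a: "mono_on S a" and mono_b: "mono_on S b"
begin

abbreviation "M \<equiv> transversal_matroid S I N"

definition incident :: "'a set \<Rightarrow> nat set" where
  "incident X = {n \<in> I. X \<inter> N n \<noteq> {}}"

lemma ground_eq: "ground M = S"
  by (simp add: ground_def transversal_matroid_def)

lemma indep_iff:
  "X \<in> indep_sets M \<longleftrightarrow> X \<subseteq> S \<and> (\<exists>f. inj_on f X \<and> (\<forall>x \<in> X. f x \<in> I \<and> x \<in> N (f x)))"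
  by (simp add: indep_sets_def transversal_matroid_def partial_transversal_def)

lemma indep_iff_interval:
  "X \<in> indep_sets M \<longleftrightarrow> X \<subseteq> S \<and> (\<exists>f. inj_on f X \<and> (\<forall>x \<in> X. a x \<le> f x \<and> f x \<le> b x))"
proof -
  have "f x \<in> I \<and> x \<in> N (f x) \<longleftrightarrow> a x \<le> f x \<and> f x \<le> b x" if "x \<in> S" for f x
    using that mem_iff[of x "f x"] interval_subset[of x] by auto
  then show ?thesis
    unfolding indep_iff by (meson subsetD)
qed

lemma indep_mono: "X \<in> indep_sets M \<Longrightarrow> Y \<subseteq> X \<Longrightarrow> Y \<in> indep_sets M"
  unfolding indep_iff by (meson inj_on_subset subset_iff)

text \<open>Independence is hereditary, and every proper subset of \<open>C\<close> lies in some
  \<open>C - {x}\<close>.\<close>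

lemma circuit_iff_delete:
  assumes "C \<subseteq> S"
  shows "circuit M C \<longleftrightarrow> C \<notin> indep_sets M \<and> (\<forall>x \<in> C. C - {x} \<in> indep_sets M)"
proof -
  have "X \<in> indep_sets M" if del: "\<forall>x \<in> C. C - {x} \<in> indep_sets M" and sub: "X \<subset> C" for X
  proof -
    obtain x where "x \<in> C" "X \<subseteq> C - {x}" using sub by blast
    then show ?thesis using del indep_mono by blast
  qed
  then show ?thesis
    using assms by (auto simp: circuit_def ground_eq)
qed

text \<open>The easy half of Hall's theorem.\<close>

lemma card_le_incident:
  assumes "X \<in> indep_sets M" and "X \<subseteq> Y" and "finite (incident Y)"
  shows "card X \<le> card (incident Y)"
proof -
  obtain f where "inj_on f X" "\<forall>x \<in> X. f x \<in> I \<and> x \<in> N (f x)"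
    using assms(1) by (auto simp: indep_iff)
  then show ?thesis
    using assms(2,3) by (intro card_inj_on_le[of f]) (auto simp: incident_def)
qed

text \<open>Monotone ends confine a matching of \<open>X\<close> to \<open>{a l..b u}\<close>. The
  empty set is excepted because \<open>b u\<close> may then lie far below
  \<open>a l\<close>.\<close>

lemma card_le_span:
  assumes "X \<in> indep_sets M" and "l \<in> S" and "u \<in> S" and "\<And>x. x \<in> X \<Longrightarrow> l \<le> x \<and> x \<le> u"
  shows "card X + a l \<le> Suc (b u) \<or> X = {}"
proof -
  obtain f where f: "inj_on f X" "\<And>x. x \<in> X \<Longrightarrow> a x \<le> f x \<and> f x \<le> b x" and "X \<subseteq> S"
    using assms(1) by (auto simp: indep_iff_interval)
  have im: "f ` X \<subseteq> {a l..b u}"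
  proof (rule image_subsetI)
    fix x assume x: "x \<in> X"
    then have "a l \<le> a x" "b x \<le> b u"
      using mono_onD[OF mono_a] mono_onD[OF mono_b] assms \<open>X \<subseteq> S\<close> by auto
    then show "f x \<in> {a l..b u}" using f(2)[OF x] by simp
  qed
  then have "card X \<le> Suc (b u) - a l"
    using card_inj_on_le[OF f(1) im] by simp
  moreover have "a l \<le> b u" if "X \<noteq> {}" using im that by fastforce
  ultimately show ?thesis by (cases "X = {}") simp_all
qed

end

section \<open>Circuits among increasingly enumerated sets\<close>

locale enumerated_subset = interval_presentation S I N a b
  for S :: "'a :: linorder set" and I N a b +
  fixes c :: "nat \<Rightarrow> 'a" and k :: nat
  assumes subset: "c ` {0..k} \<subseteq> S" and strict_c: "strict_mono_on {0..k} c"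
begin

abbreviation "C \<equiv> c ` {0..k}"

lemma c_mem: "j \<le> k \<Longrightarrow> c j \<in> S"
  using subset by auto

lemma c_le: "u \<le> v \<Longrightarrow> v \<le> k \<Longrightarrow> c u \<le> c v"
  using strict_mono_on_leD[OF strict_c, of u v] by simp

lemma inj_c: "inj_on c {0..k}"
  using strict_c by (rule strict_mono_on_imp_inj_on)

lemma a_le: "u \<le> v \<Longrightarrow> v \<le> k \<Longrightarrow> a (c u) \<le> a (c v)"
  using mono_onD[OF mono_a] c_mem c_le by simp

lemma b_le: "u \<le> v \<Longrightarrow> v \<le> k \<Longrightarrow> b (c u) \<le> b (c v)"
  using mono_onD[OF mono_b] c_mem c_le by simp

lemma indep_subset_image:
  assumes J: "J \<subseteq> {0..k}" and "inj_on g J"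
    and g: "\<And>j. j \<in> J \<Longrightarrow> a (c j) \<le> g j \<and> g j \<le> b (c j)"
  shows "c ` J \<in> indep_sets M"
proof -
  have inj: "inj_on c J" using inj_c J by (rule inj_on_subset)
  have "inj_on (g \<circ> inv_into J c) (c ` J)"
    using assms(2) inj by (auto simp: inj_on_def)
  then show ?thesis
    unfolding indep_iff_interval using J subset g inj
    by (intro conjI exI[of _ "g \<circ> inv_into J c"]) auto
qed

lemma segment_bound:
  assumes "c ` {u..v} \<in> indep_sets M" and "u \<le> v" and "v \<le> k"
  shows "a (c u) + (v - u) \<le> b (c v)"
proof -
  have "card (c ` {u..v}) = Suc v - u"
    using assms inj_on_subset[OF inj_c, of "{u..v}"] by (simp add: card_image)
  moreover have "c ` {u..v} \<noteq> {}" using assms(2) by simp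
  moreover have "c u \<le> x \<and> x \<le> c v" if "x \<in> c ` {u..v}" for x
    using that assms c_le by auto
  ultimately have "Suc v - u + a (c u) \<le> Suc (b (c v))"
    using card_le_span[OF assms(1), of "c u" "c v"] assms c_mem by auto
  then show ?thesis using assms(2) by linarith
qed

text \<open>Each lower end \<open>a (c u)\<close> forces a strictly increasing assignment to reach
  at least \<open>a (c u) + (v - u)\<close> at \<open>c v\<close>. The greedy choice is the largest
  of these demands, and the hypothesis keeps it within \<open>b (c v)\<close>.\<close>

lemma indep_if_segment_bounds:
  assumes "\<And>u v. u \<le> v \<Longrightarrow> v \<le> k \<Longrightarrow> a (c u) + (v - u) \<le> b (c v)"
  shows "C \<in> indep_sets M"
proof -
  \<comment> \<open>the least value that a strictly increasing assignment can take at \<open>c v\<close>\<close>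
  define g where "g v = Max ((\<lambda>u. a (c u) + (v - u)) ` {0..v})" for v
  have ge: "a (c u) + (v - u) \<le> g v" if "u \<le> v" for u v
    using that by (auto simp: g_def)
  have attained: "\<exists>u \<le> v. g v = a (c u) + (v - u)" for v
  proof -
    have "g v \<in> (\<lambda>u. a (c u) + (v - u)) ` {0..v}"
      unfolding g_def by (rule Max_in) auto
    then show ?thesis by (blast dest: atLeastAtMost_iff[THEN iffD1])
  qed
  have "g v < g w" if "v < w" for v w
  proof -
    obtain u where "u \<le> v" "g v = a (c u) + (v - u)" using attained by blast
    \<comment> \<open>The \<open>u\<close> attaining the maximum for \<open>v\<close> also competes
      for \<open>w\<close>, with a larger offset.\<close>
    then show ?thesis using ge[of u w] that by simp
  qed
  then have "strict_mono g" by (rule strict_monoI)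
  moreover have "g v \<le> b (c v)" if "v \<le> k" for v
    using attained[of v] assms that by auto
  moreover have "a (c v) \<le> g v" for v using ge[of v v] by simp
  ultimately show ?thesis
    by (intro indep_subset_image[of _ g]) (auto simp: strict_mono_imp_inj_on)
qed

lemma incident_subset: "incident C \<subseteq> {a (c 0)..b (c k)}"
proof
  fix n assume "n \<in> incident C"
  then obtain j where j: "j \<le> k" "n \<in> I" "c j \<in> N n" by (auto simp: incident_def)
  then show "n \<in> {a (c 0)..b (c k)}"
    using mem_iff[OF c_mem] a_le[of 0 j] b_le[of j k] by fastforce
qed

lemma circuit_proper_segment_bound:
  assumes circ: "circuit M C" and "u \<le> v" and "v \<le> k" and proper: "0 < u \<or> v < k"
  shows "a (c u) + (v - u) \<le> b (c v)"
proof -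
  have "{u..v} \<subset> {0..k}"
    using assms(2,3) proper by auto
  then have "c ` {u..v} \<subset> C"
    by (rule image_strict_mono[OF inj_c])
  then have "c ` {u..v} \<in> indep_sets M"
    using circ unfolding circuit_def by blast
  then show ?thesis
    using assms(2,3) by (rule segment_bound)
qed

lemma circuit_span:
  assumes circ: "circuit M C"
  shows "b (c k) < a (c 0) + k"
proof (rule ccontr)
  assume full: "\<not> b (c k) < a (c 0) + k"
  have "a (c u) + (v - u) \<le> b (c v)" if "u \<le> v" "v \<le> k" for u v
    using circuit_proper_segment_bound[OF circ that] full that by (cases "u = 0 \<and> v = k") auto
  then show False
    using indep_if_segment_bounds circ unfolding circuit_def by blast
qed

text \<open>\<open>circuit_span\<close> leaves room for at most \<open>k\<close> incident indices,
  while matching \<open>C - {c 0}\<close> already uses \<open>k\<close> of them.\<close>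

lemma circuit_incident:
  assumes circ: "circuit M C"
  shows "incident C = {a (c 0)..<a (c 0) + k}"
proof -
  have sub: "incident C \<subseteq> {a (c 0)..<a (c 0) + k}"
    using incident_subset circuit_span[OF circ] by fastforce
  have "card (C - {c 0}) = k"
    by (simp add: card_image[OF inj_c])
  moreover have "C - {c 0} \<in> indep_sets M"
    using circ unfolding circuit_iff_delete[OF subset] by simp
  ultimately have "k \<le> card (incident C)"
    using card_le_incident[of "C - {c 0}" C] finite_subset[OF sub] by (simp add: Diff_subset)
  with sub show ?thesis
    by (intro card_seteq) auto
qed

text \<open>By \<open>circuit_incident\<close> the two values are the (j+1)-st and the j-th incident
  index. Initial segments bound \<open>b (c j)\<close> from below; final segments with
  \<open>circuit_span\<close> bound \<open>a (c j)\<close> from above.\<close>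

lemma circuit_incidences:
  assumes circ: "circuit M C" and "j \<le> k"
  shows "j < k \<Longrightarrow> c j \<in> N (a (c 0) + j)" and "0 < j \<Longrightarrow> c j \<in> N (a (c 0) + j - 1)"
proof -
  have I: "{a (c 0)..<a (c 0) + k} \<subseteq> I"
    using circuit_incident[OF circ] by (auto simp: incident_def)
  have lower_j: "a (c j) < a (c 0) + j" if "0 < j"
    using circuit_proper_segment_bound[OF circ, of j k] that circuit_span[OF circ] assms(2) by simp
  have lower_j': "a (c j) \<le> a (c 0) + j"
    using lower_j by (cases "j = 0") auto
  have upper_j: "a (c 0) + j \<le> b (c j)" if "j < k"
    using circuit_proper_segment_bound[OF circ, of 0 j] that by simp
  \<comment> \<open>For \<open>j = k\<close> the segment from 0 to \<open>j\<close> is not proper,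
    so the one ending at \<open>j - 1\<close> is used together with monotonicity of
    \<open>b\<close>.\<close>
  have upper_j': "a (c 0) + j - 1 \<le> b (c j)" if "0 < j"
  proof -
    have "a (c 0) + (j - 1) \<le> b (c (j - 1))"
      using circuit_proper_segment_bound[OF circ, of 0 "j - 1"] that assms(2) by simp
    also have "\<dots> \<le> b (c j)"
      using assms(2) by (intro b_le) simp_all
    finally show ?thesis using that by simp
  qed
  show "c j \<in> N (a (c 0) + j)" if "j < k"
    using that lower_j' upper_j I by (subst mem_iff[OF c_mem]) auto
  show "c j \<in> N (a (c 0) + j - 1)" if "0 < j"
  proof -
    have "a (c 0) + j - 1 \<in> I"
      using that assms(2) by (intro subsetD[OF I]) auto
    then show ?thesis
      using mem_iff[OF c_mem[OF assms(2)]] lower_j[OF that] upper_j'[OF that] by simp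
  qed
qed

lemma circuit_if_incidences:
  assumes i: "incident C = i ` {1..k}" "strict_mono_on {1..k} i"
    and c: "\<And>j. j < k \<Longrightarrow> c j \<in> N (i (Suc j))" "\<And>j. 0 < j \<Longrightarrow> j \<le> k \<Longrightarrow> c j \<in> N (i j)"
  shows "circuit M C"
  unfolding circuit_iff_delete[OF subset]
proof (intro conjI ballI notI)
  \<comment> \<open>There are \<open>k + 1\<close> elements but at most \<open>k\<close> incident
    indices.\<close>
  assume "C \<in> indep_sets M"
  then have "card C \<le> card (incident C)"
    by (rule card_le_incident) (simp_all add: i(1))
  also have "\<dots> \<le> k"
    using card_image_le[of "{1..k}" i] by (simp add: i(1))
  finally show False
    by (simp add: card_image[OF inj_c])
next
  fix x assume "x \<in> C"
  then obtain h where h: "h \<le> k" "x = c h" by auto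
  define J where "J = {0..k} - {h}"
  \<comment> \<open>\<open>t\<close> closes the gap at \<open>h\<close>: it maps \<open>J\<close>
    injectively to the positions \<open>{1..k}\<close>, which \<open>i\<close> turns into incident
    indices.\<close>
  define t where "t j = (if j < h then Suc j else j)" for j
  have "C - {x} = c ` J"
    unfolding J_def h(2) using h(1) by (subst inj_on_image_set_diff[OF inj_c]) auto
  moreover have "c ` J \<in> indep_sets M"
  proof (rule indep_subset_image[of J "i \<circ> t"])
    show "J \<subseteq> {0..k}" by (auto simp: J_def)
    have t: "t ` J \<subseteq> {1..k}"
      unfolding image_subset_iff t_def J_def using h(1) by simp
    have "inj_on t J"
    proof (rule inj_onI)
      fix u v assume "u \<in> J" "v \<in> J" "t u = t v"
      then show "u = v" unfolding t_def J_def by (simp split: if_splits)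
    qed
    then show "inj_on (i \<circ> t) J"
      using inj_on_subset[OF strict_mono_on_imp_inj_on[OF i(2)] t] by (rule comp_inj_on)
    fix j assume j: "j \<in> J"
    then have "i (t j) \<in> incident C"
      unfolding i(1) using t by blast
    then have "i (t j) \<in> I" by (simp add: incident_def)
    moreover have "c j \<in> N (i (t j))"
      using j h(1) c[of j] by (simp add: t_def J_def)
    moreover have "c j \<in> S" using j c_mem by (auto simp: J_def)
    ultimately show "a (c j) \<le> (i \<circ> t) j \<and> (i \<circ> t) j \<le> b (c j)"
      by (simp add: mem_iff)
  qed
  ultimately show "C - {x} \<in> indep_sets M" by simp
qed

end

section \<open>Application to lattice path matroids\<close>

lemma lattice_path_interval_presentation:
  assumes P: "P \<in> lattice_paths m r" and Q: "Q \<in> lattice_paths m r" and PQ: "never_above P Q"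
  shows "interval_presentation {1..m + r} {1..r} (north_set m r P Q)
           (\<lambda>j. Suc (height P (j - 1))) (height Q)"
proof
  show "j \<in> north_set m r P Q n \<longleftrightarrow> Suc (height P (j - 1)) \<le> n \<and> n \<le> height Q j"
    if "j \<in> {1..m + r}" for j n
    using that by (rule north_set_iff[OF assms])
  \<comment> \<open>The \<open>Suc\<close> keeps lower ends at least 1; upper ends are at most
    \<open>r\<close> because \<open>Q\<close> ends at height \<open>r\<close>.\<close>
  show "{Suc (height P (j - 1))..height Q j} \<subseteq> {1..r}" if "j \<in> {1..m + r}" for j
    using prefix_count_mono[of j "m + r" Q North] Q that by (auto simp: lattice_paths_iff)
  show "mono_on {1..m + r} (\<lambda>j. Suc (height P (j - 1)))"
    by (intro mono_onI) (simp add: prefix_count_mono diff_le_mono)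
  show "mono_on {1..m + r} (height Q)"
    by (intro mono_onI) (simp add: prefix_count_mono)
qed

text \<open>For \<open>k = 0\<close> there is no first or k-th index to refer to; the guards
  \<open>1 \<le> k\<close> then reduce the conditions to \<open>s = 0\<close>, which says that the
  single element is a loop.\<close>

theorem theorem3p9:
  fixes m r k s :: nat
    and P Q :: lattice_path
    and C :: "nat set"
    and c i :: "nat \<Rightarrow> nat"
  assumes "P \<in> lattice_paths m r" and "Q \<in> lattice_paths m r" and "never_above P Q"
    and "C \<subseteq> ground (lattice_path_matroid m r P Q)"
    and "C = c ` {0..k}" and "strict_mono_on {0..k} c"
    and "incidence m r P Q C = i ` {1..s}" and "strict_mono_on {1..s} i"
  shows "(circuit (lattice_path_matroid m r P Q) C \<longleftrightarrow>
           s = k \<and>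
           (1 \<le> k \<longrightarrow> c 0 \<in> north_set m r P Q (i 1)) \<and>
           (1 \<le> k \<longrightarrow> c k \<in> north_set m r P Q (i k)) \<and>
           (\<forall>j. 0 < j \<and> j < k \<longrightarrow>
              c j \<in> north_set m r P Q (i j) \<inter> north_set m r P Q (i (j + 1)))) \<and>
         (circuit (lattice_path_matroid m r P Q) C \<longrightarrow>
           (\<forall>h. 1 \<le> h \<and> h < k \<longrightarrow> i (h + 1) = i h + 1))"
    (is "(?circ \<longleftrightarrow> ?conds) \<and> (?circ \<longrightarrow> ?consec)")
proof -
  let ?N = "north_set m r P Q"
  define a where "a j = Suc (height P (j - 1))" for j
  interpret interval_presentation "{1..m + r}" "{1..r}" ?N a "height Q"
    using lattice_path_interval_presentation[OF assms(1-3)] by (simp add: a_def[abs_def])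
  interpret enumerated_subset "{1..m + r}" "{1..r}" ?N a "height Q" c k
    using assms(4-6) ground_eq by unfold_locales (simp_all add: lattice_path_matroid_def)
  have incident: "incident (c ` {0..k}) = i ` {1..s}"
    unfolding incident_def using assms(5,7) by (simp add: incidence_def)
  have circ_iff: "?circ \<longleftrightarrow> circuit M (c ` {0..k})"
    using assms(5) by (simp add: lattice_path_matroid_def)
  have "?conds \<and> ?consec" if ?circ
  proof -
    have circ: "circuit M (c ` {0..k})" using that circ_iff by simp
    have im: "i ` {1..s} = {a (c 0)..<a (c 0) + k}"
      using circuit_incident[OF circ] incident by simp
    \<comment> \<open>Compare the cardinalities of the two descriptions of the incident set.\<close>
    have s: "s = k"
      using card_image[OF strict_mono_on_imp_inj_on[OF assms(8)]] im by simp
    have i: "Suc (i h) = a (c 0) + h" if "1 \<le> h" "h \<le> k" for h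
      using strict_mono_on_enum_interval[OF assms(8)[unfolded s] im[unfolded s]] that by simp
    have up: "c j \<in> ?N (i (j + 1))" if "j < k" for j
    proof -
      have "i (j + 1) = a (c 0) + j" using i[of "j + 1"] that by simp
      then show ?thesis using circuit_incidences(1)[OF circ] that by simp
    qed
    have low: "c j \<in> ?N (i j)" if "0 < j" "j \<le> k" for j
    proof -
      have "i j = a (c 0) + j - 1" using i[of j] that by simp
      then show ?thesis using circuit_incidences(2)[OF circ] that by simp
    qed
    have ?conds
      using s up[of 0] up low by simp
    moreover have ?consec
    proof (intro allI impI)
      fix h assume "1 \<le> h \<and> h < k"
      then show "i (h + 1) = i h + 1" using i[of h] i[of "h + 1"] by simp
    qed
    ultimately show ?thesis ..
  qed
  moreover have ?circ if conds: ?conds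
    unfolding circ_iff
  proof (rule circuit_if_incidences)
    have "s = k" using conds by blast
    then show "incident (c ` {0..k}) = i ` {1..k}" "strict_mono_on {1..k} i"
      using incident assms(8) by simp_all
    \<comment> \<open>The end conditions supply \<open>j = 0\<close> here and \<open>j = k\<close>
      below; all other \<open>j\<close> come from the intersections.\<close>
    show "c j \<in> ?N (i (Suc j))" if "j < k" for j
      using conds that by (cases "j = 0") simp_all
    show "c j \<in> ?N (i j)" if "0 < j" "j \<le> k" for j
      using conds that by (cases "j = k") simp_all
  qed
  ultimately show ?thesis by blast
qed

end
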